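(* Suppose that $E_o \subset \mathbb{Z}$ is an aperiodic Bohr$_o$-set. Then $$\{ xy - z^2 : x,y,z \in E_o \} = \mathbb{Z}.$$
   Context: $E_o \subset \mathbb{Z}$ is an aperiodic Bohr$_o$-set if there exist a compact, connected, second countable abelian group $K$ with Haar probability measure $m_K$, a homomorphism $\tau : \mathbb{Z} \to K$ with dense image, and an open set $U \subset K$ containing the identity element of $K$ with $m_K(\overline{U}) = m_K(U)$ such that $E_o = \tau^{-1}(U)$. *)

theory Defs
  imports "HOL-Probability.Probability"
begin

definition haar_probability :: "'k::topological_ab_group_add measure \<Rightarrow> bool" where
  "haar_probability m \<longleftrightarrow>
     prob_space m \<and> sets m = sets borel \<and>
     (\<forall>a. \<forall>A\<in>sets borel. emeasure m ((+) a ` A) = emeasure m A)"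

text \<open>
  The compact group is the whole type \<open>'k\<close>, written additively. HOL cannot quantify
  existentially over types, so the type is passed as a parameter: a set is an aperiodic
  Bohr-o set iff the predicate holds for some \<open>'k\<close>, and a theorem that has it as a hypothesis
  with \<open>'k\<close> a free type variable therefore speaks about all aperiodic Bohr-o sets.
  Compact groups are understood to be Hausdorff.

  The Haar probability measure of such a group exists and is unique, so the existential
  quantifier over \<open>m\<close> just names it.
\<close>

definition aperiodic_Bohr0 ::
  "'k::{topological_ab_group_add, t2_space, second_countable_topology} itself
     \<Rightarrow> int set \<Rightarrow> bool" where
  "aperiodic_Bohr0 _ E \<longleftrightarrow>
     compact (UNIV :: 'k set) \<and> connected (UNIV :: 'k set) \<and>
     (\<exists>(m :: 'k measure) (\<tau> :: int \<Rightarrow> 'k) (U :: 'k set).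
        haar_probability m \<and>
        (\<forall>i j. \<tau> (i + j) = \<tau> i + \<tau> j) \<and> closure (range \<tau>) = UNIV \<and>
        open U \<and> 0 \<in> U \<and> measure m (closure U) = measure m U \<and>
        E = \<tau> -` U)"

end

theory Submission
  imports Defs
begin

text \<open>
  Write \<open>H\<close> for the set of all limits of \<open>\<tau> (u\<^sub>i\<^sup>2)\<close> along integer sequences with
  \<open>\<tau> u\<^sub>i \<longrightarrow> 0\<close>. The heart of the proof is that \<open>H\<close> is the whole group; this replaces Weyl
  equidistribution of squares and makes characters unnecessary. \<open>H\<close> is a
  closed subgroup, and it acts on the closure \<open>X\<close> of \<open>{(\<tau> t, \<tau> (t\<^sup>2))}\<close> by translation of the
  second coordinate. Conversely, two points of \<open>X\<close> on the same fibre differ by an element of \<open>H\<close>,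
  because both can be moved to the fibre over \<open>0\<close> by shifting \<open>t\<close>. Connectedness makes
  \<open>\<tau> (n \<int>)\<close> dense for each \<open>n > 0\<close>, so for any \<open>c\<close> there are \<open>n\<^sub>i > 0\<close> and \<open>j\<^sub>i\<close> with
  \<open>\<tau> n\<^sub>i \<longrightarrow> 0\<close> and \<open>\<tau> (n\<^sub>i j\<^sub>i) \<longrightarrow> c\<close>; comparing \<open>j\<^sub>i\<close> with \<open>j\<^sub>i + n\<^sub>i\<close> gives
  \<open>2 c \<in> H\<close>.

  To represent \<open>n\<close>, first choose \<open>s\<close> with \<open>x = s\<^sup>2 + n > 0\<close> in the Bohr set, and then \<open>t\<close> such
  that \<open>z = s + x t\<close> and \<open>y = 1 + 2 s t + x t\<^sup>2\<close> are in it as well; identically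
  \<open>x y - z\<^sup>2 = n\<close>.
\<close>

section \<open>Sequences and closed subsemigroups in compact groups\<close>

lemma closure_range_sequence:
  fixes c :: "'a::first_countable_topology"
  assumes "\<And>i. c \<in> closure (range (f i))"
  obtains u where "(\<lambda>i. f i (u i)) \<longlonglongrightarrow> c"
proof -
  obtain N :: "nat \<Rightarrow> 'a set" where N: "\<And>i. open (N i)" "\<And>i. c \<in> N i"
    "\<And>F. (\<forall>n. F n \<in> N n) \<Longrightarrow> F \<longlonglongrightarrow> c"
    by (rule first_countable_topology_class.countable_basis) blast
  have "\<exists>t. f i t \<in> N i" for i
    using assms[of i] N(1,2)[of i] by (auto simp: closure_iff_nhds_not_empty)
  then obtain u where "\<forall>i. f i (u i) \<in> N i" by metis
  then show thesis by (intro that N(3))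
qed

lemma closed_add_vimage:
  fixes S :: "'a::{topological_comm_monoid_add, t2_space} set"
  assumes "closed S"
  shows "closed ((\<lambda>x. a + x) -` S)"
  using assms by (intro continuous_closed_vimage) (auto simp: isCont_def intro!: tendsto_intros)

lemma compact_convergent_subseq:
  fixes f :: "nat \<Rightarrow> 'a::first_countable_topology"
  assumes "compact (UNIV :: 'a set)"
  obtains l r where "strict_mono (r :: nat \<Rightarrow> nat)" and "(\<lambda>i. f (r i)) \<longlonglongrightarrow> l"
  using compact_imp_seq_compact[OF assms] unfolding seq_compact_def o_def by blast

text \<open>The multiples of \<open>h\<close> accumulate somewhere, so differences of later and
  earlier ones along a subsequence tend to 0. Each is a positive multiple; removing one
  \<open>h\<close> leaves a nonnegative multiple, still in \<open>S\<close>, and the limit is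
  \<open>- h\<close>.\<close>

lemma compact_add_closed_uminus:
  fixes S :: "'a::{topological_ab_group_add, first_countable_topology} set"
  assumes comp: "compact (UNIV :: 'a set)" and "closed S"
    and zero: "0 \<in> S" and add: "\<And>x y. x \<in> S \<Longrightarrow> y \<in> S \<Longrightarrow> x + y \<in> S" and h: "h \<in> S"
  shows "- h \<in> S"
proof -
  define f where "f k = (\<Sum>i<k. h)" for k :: nat
  have f_add: "f (j + k) = f j + f k" for j k
    unfolding f_def by (induction k) (auto simp: add_ac)
  have f_S: "f k \<in> S" for k
    unfolding f_def by (induction k) (auto simp: zero add h)
  have f_1: "f (Suc 0) = h" by (simp add: f_def)
  obtain l r where r: "strict_mono (r :: nat \<Rightarrow> nat)" and l: "(\<lambda>i. f (r i)) \<longlonglongrightarrow> l"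
    using compact_convergent_subseq[OF comp] by blast
  have lim: "(\<lambda>i. f (r (Suc i)) - f (r i) - h) \<longlonglongrightarrow> l - l - h"
    by (intro tendsto_intros l LIMSEQ_Suc[OF l])
  have "f (r (Suc i)) - f (r i) - h \<in> S" for i
  proof -
    have "r i < r (Suc i)" using r by (simp add: strict_mono_Suc_iff)
    then have "r (Suc i) = r i + (Suc 0 + (r (Suc i) - r i - 1))" by simp
    then have "f (r (Suc i)) = f (r i) + (h + f (r (Suc i) - r i - 1))"
      by (metis f_add f_1)
    then show ?thesis using f_S by (simp add: algebra_simps)
  qed
  with \<open>closed S\<close> have "l - l - h \<in> S"
    using lim by (rule closed_sequentially)
  then show ?thesis by simp
qed

section \<open>Integers dense in a compact connected group\<close>

locale dense_integers =
  fixes \<tau> :: "int \<Rightarrow> 'k::{topological_ab_group_add, t2_space, second_countable_topology}"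
  assumes compact_UNIV: "compact (UNIV :: 'k set)"
    and connected_UNIV: "connected (UNIV :: 'k set)"
    and add: "\<tau> (i + j) = \<tau> i + \<tau> j"
    and dense: "closure (range \<tau>) = UNIV"
begin

lemma zero [simp]: "\<tau> 0 = 0"
  using add[of 0 0] by simp

lemma minus: "\<tau> (- i) = - \<tau> i"
  using add[of i "- i"] by (simp add: eq_neg_iff_add_eq_0 add.commute)

lemma diff: "\<tau> (i - j) = \<tau> i - \<tau> j"
  using add[of i "- j"] by (simp add: minus)

lemma closed_invariant_UNIV:
  assumes "closed S" and "x \<in> S" and "\<And>y m. y \<in> S \<Longrightarrow> y + \<tau> m \<in> S"
  shows "S = UNIV"
proof -
  have "closure (range \<tau>) \<subseteq> (\<lambda>z. x + z) -` S"
    using assms by (intro closure_minimal closed_add_vimage) auto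
  then have "x + (w - x) \<in> S" for w using dense by blast
  then show ?thesis by auto
qed

text \<open>Multiplication by a fixed \<open>k\<close> is a finite sum up to sign, hence continuous
  at 0. Cross terms of squares are killed this way below, which is why their other factor is frozen
  first.\<close>

lemma tendsto_mult_zero:
  assumes "(\<lambda>i. \<tau> (u i)) \<longlonglongrightarrow> 0"
  shows "(\<lambda>i. \<tau> (k * u i)) \<longlonglongrightarrow> 0"
proof -
  have nat: "(\<lambda>i. \<tau> (int n * u i)) \<longlonglongrightarrow> 0" for n
  proof (induction n)
    case (Suc n)
    have "(\<lambda>i. \<tau> (u i) + \<tau> (int n * u i)) \<longlonglongrightarrow> 0 + 0"
      by (intro tendsto_add assms Suc)
    then show ?case by (simp add: add[symmetric] distrib_right)
  qed simp
  show ?thesis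
  proof (cases "k \<ge> 0")
    case True
    then show ?thesis using nat[of "nat k"] by simp
  next
    case False
    then show ?thesis using tendsto_minus[OF nat[of "nat (- k)"]] by (simp add: minus)
  qed
qed

text \<open>The closure \<open>C\<close> is a closed subgroup with at most \<open>n\<close> cosets,
  so its complement is closed too; connectedness leaves only one coset.\<close>

lemma dense_multiples:
  assumes "n > 0"
  shows "closure (range (\<lambda>j. \<tau> (n * j))) = UNIV"
proof -
  define C where "C = closure (range (\<lambda>j. \<tau> (n * j)))"
  have C_diff: "x - y \<in> C" if "x \<in> C" "y \<in> C" for x y
  proof -
    obtain p where p: "(\<lambda>i. \<tau> (n * p i)) \<longlonglongrightarrow> x"
      using \<open>x \<in> C\<close> unfolding C_def by (rule closure_range_sequence)
    obtain q where q: "(\<lambda>i. \<tau> (n * q i)) \<longlonglongrightarrow> y"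
      using \<open>y \<in> C\<close> unfolding C_def by (rule closure_range_sequence)
    have "\<tau> (n * p i) - \<tau> (n * q i) \<in> C" for i
    proof -
      have "\<tau> (n * p i) - \<tau> (n * q i) = \<tau> (n * (p i - q i))"
        by (simp add: right_diff_distrib diff)
      then show ?thesis
        unfolding C_def using closure_subset[of "range (\<lambda>j. \<tau> (n * j))"] by auto
    qed
    moreover have "(\<lambda>i. \<tau> (n * p i) - \<tau> (n * q i)) \<longlonglongrightarrow> x - y"
      by (intro tendsto_intros p q)
    ultimately show ?thesis by (rule closed_sequentially[rotated]) (simp add: C_def)
  qed
  have C_0: "0 \<in> C"
    using closure_subset[of "range (\<lambda>j. \<tau> (n * j))"] zero
    unfolding C_def by (metis mult_zero_right rangeI subsetD)
  have C_add: "x + y \<in> C" if "x \<in> C" "y \<in> C" for x y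
    using C_diff[OF that(1) C_diff[OF C_0 that(2)]] by simp
  have closed_coset: "closed ((\<lambda>x. - \<tau> i + x) -` C)" for i
    by (intro closed_add_vimage) (simp add: C_def)
  \<comment> \<open>The union of the cosets of \<open>C\<close> other than \<open>C\<close>
    itself.\<close>
  define B where "B = (\<Union>i\<in>{i\<in>{0..<n}. \<tau> i \<notin> C}. (\<lambda>x. - \<tau> i + x) -` C)"
  have "closed B" unfolding B_def 
    by (intro closed_UN ballI closed_coset finite_Collect_conjI disjI1) simp
  have "closed (B \<union> C)" using \<open>closed B\<close> by (auto simp: C_def)
  have "\<tau> j \<in> B \<union> C" for j
  proof -
    have mod: "- \<tau> (j mod n) + \<tau> j \<in> C"
    proof -
      have "\<tau> j = \<tau> (j mod n + n * (j div n))" by simp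
      then have "- \<tau> (j mod n) + \<tau> j = \<tau> (n * (j div n))" by (simp only: add) simp
      then show ?thesis
        unfolding C_def using closure_subset[of "range (\<lambda>j. \<tau> (n * j))"] by auto
    qed
    show ?thesis
    proof (cases "\<tau> (j mod n) \<in> C")
      case True
      from C_add[OF this mod] show ?thesis by simp
    next
      case False
      with mod show ?thesis using \<open>n > 0\<close> unfolding B_def
        by (auto intro!: exI[of _ "j mod n"])
    qed
  qed
  then have "closure (range \<tau>) \<subseteq> B \<union> C"
    using \<open>closed (B \<union> C)\<close> by (intro closure_minimal) auto
  moreover have "B \<inter> C = {}"
    using C_diff unfolding B_def by fastforce
  ultimately have "B = {}"
    using connected_UNIV \<open>closed B\<close> C_0 unfolding connected_closed dense
    by (metis C_def Int_UNIV_right closed_closure empty_iff)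
  with \<open>closure (range \<tau>) \<subseteq> B \<union> C\<close> show ?thesis by (auto simp: dense C_def)
qed

text \<open>Return times to 0 are gaps between the indices of a convergent subsequence.\<close>

lemma recurrence:
  obtains u :: "nat \<Rightarrow> int" where "\<And>i. u i > 0" and "(\<lambda>i. \<tau> (u i)) \<longlonglongrightarrow> 0"
proof -
  obtain l r where r: "strict_mono (r :: nat \<Rightarrow> nat)" and l: "(\<lambda>i. \<tau> (int (r i))) \<longlonglongrightarrow> l"
    using compact_convergent_subseq[OF compact_UNIV, of "\<lambda>i. \<tau> (int i)"] by blast
  have "(\<lambda>i. \<tau> (int (r (Suc i))) - \<tau> (int (r i))) \<longlonglongrightarrow> l - l"
    by (intro tendsto_diff LIMSEQ_Suc[OF l] l)
  then show thesis
    using r by (intro that[of "\<lambda>i. int (r (Suc i)) - int (r i)"])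
      (auto simp: diff strict_mono_Suc_iff)
qed

section \<open>Joint limits of integers and their squares\<close>

definition squares_closure :: "('k \<times> 'k) set" where
  "squares_closure = closure (range (\<lambda>t. (\<tau> t, \<tau> (t\<^sup>2))))"

lemma closed_squares_closure: "closed squares_closure"
  by (simp add: squares_closure_def)

lemma squares_closureI:
  assumes "(\<lambda>i. \<tau> (u i)) \<longlonglongrightarrow> x" and "(\<lambda>i. \<tau> ((u i)\<^sup>2)) \<longlonglongrightarrow> y"
  shows "(x, y) \<in> squares_closure"
  unfolding squares_closure_def closure_sequential
  by (intro exI[of _ "\<lambda>i. (\<tau> (u i), \<tau> ((u i)\<^sup>2))"] conjI allI rangeI tendsto_Pair assms)

lemma squares_closureE:
  assumes "(x, y) \<in> squares_closure"
  obtains u where "(\<lambda>i. \<tau> (u i)) \<longlonglongrightarrow> x" and "(\<lambda>i. \<tau> ((u i)\<^sup>2)) \<longlonglongrightarrow> y"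
proof -
  obtain u where "(\<lambda>i. (\<tau> (u i), \<tau> ((u i)\<^sup>2))) \<longlonglongrightarrow> (x, y)"
    using assms unfolding squares_closure_def by (rule closure_range_sequence)
  from that[OF tendsto_fst[OF this, simplified] tendsto_snd[OF this, simplified]] show thesis .
qed

text \<open>The group \<open>H\<close> of the overview, as the fibre over 0 of \<open>X\<close>,
  which is \<open>squares_closure\<close>.\<close>

definition square_limits :: "'k set" where
  "square_limits = {h. (0, h) \<in> squares_closure}"

text \<open>Adding \<open>u i\<close> to a fixed integer \<open>s\<close> changes its square by
  \<open>(u i)\<^sup>2\<close> and a cross term tending to 0. General points follow by closedness;
  doing both limits at once would leave the cross term uncontrolled.\<close>

lemma squares_closure_add:
  assumes h: "h \<in> square_limits" and p: "(x, y) \<in> squares_closure"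
  shows "(x, y + h) \<in> squares_closure"
proof -
  obtain u where u: "(\<lambda>i. \<tau> (u i)) \<longlonglongrightarrow> 0" "(\<lambda>i. \<tau> ((u i)\<^sup>2)) \<longlonglongrightarrow> h"
    using h unfolding square_limits_def by (auto elim: squares_closureE)
  have orbit: "(\<tau> s, \<tau> (s\<^sup>2) + h) \<in> squares_closure" for s
  proof (rule squares_closureI)
    have "(\<lambda>i. \<tau> s + \<tau> (u i)) \<longlonglongrightarrow> \<tau> s + 0"
      by (intro tendsto_intros u)
    then show "(\<lambda>i. \<tau> (s + u i)) \<longlonglongrightarrow> \<tau> s" by (simp add: add)
    have "(\<lambda>i. \<tau> (s\<^sup>2) + \<tau> ((u i)\<^sup>2) + \<tau> (2 * s * u i)) \<longlonglongrightarrow> \<tau> (s\<^sup>2) + h + 0"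
      by (intro tendsto_intros u tendsto_mult_zero)
    then show "(\<lambda>i. \<tau> ((s + u i)\<^sup>2)) \<longlonglongrightarrow> \<tau> (s\<^sup>2) + h"
      by (simp add: add power2_sum)
  qed
  obtain v where v: "(\<lambda>i. \<tau> (v i)) \<longlonglongrightarrow> x" "(\<lambda>i. \<tau> ((v i)\<^sup>2)) \<longlonglongrightarrow> y"
    using p by (rule squares_closureE)
  have "(\<lambda>i. (\<tau> (v i), \<tau> ((v i)\<^sup>2) + h)) \<longlonglongrightarrow> (x, y + h)"
    by (intro tendsto_intros v)
  then show ?thesis
    by (rule closed_sequentially[OF closed_squares_closure orbit])
qed

lemma closed_square_limits: "closed square_limits"
proof -
  have "square_limits = Pair 0 -` squares_closure" by (auto simp: square_limits_def)
  moreover have "isCont (Pair (0 :: 'k)) y" for y :: 'k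
    unfolding isCont_def by (intro tendsto_intros)
  ultimately show ?thesis
    using closed_squares_closure by (metis continuous_closed_vimage)
qed

lemma square_limits_add: "h \<in> square_limits \<Longrightarrow> g \<in> square_limits \<Longrightarrow> h + g \<in> square_limits"
  using squares_closure_add[of g 0 h] by (simp add: square_limits_def)

lemma square_limits_0: "0 \<in> square_limits"
  unfolding square_limits_def by (simp, rule squares_closureI[of "\<lambda>_. 0"]) auto

lemma square_limits_uminus: "h \<in> square_limits \<Longrightarrow> - h \<in> square_limits"
  by (rule compact_add_closed_uminus[OF compact_UNIV closed_square_limits square_limits_0
        square_limits_add])

text \<open>The base points \<open>F\<close> over which the difference \<open>d\<close> occurs form
  a closed set, being the projection of a compact one, and shifting integers by \<open>m\<close>
  preserves it. By density it contains 0, where \<open>d\<close> is a difference of two elements of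
  the group \<open>square_limits\<close>.\<close>

lemma squares_closure_fibre:
  assumes "(x, y) \<in> squares_closure" and "(x, y + d) \<in> squares_closure"
  shows "d \<in> square_limits"
proof -
  define S where "S = squares_closure \<inter> (\<lambda>p. (0, d) + p) -` squares_closure"
  define F where "F = fst ` S"
  have "compact (UNIV :: ('k \<times> 'k) set)"
    using compact_Times[OF compact_UNIV compact_UNIV] by simp
  moreover have "closed S"
    unfolding S_def
  proof (intro closed_Int closed_squares_closure continuous_closed_vimage)
    show "isCont (\<lambda>p. (0, d) + p) p" for p :: "'k \<times> 'k"
    proof -
      have "((\<lambda>p. (fst p, d + snd p)) \<longlongrightarrow> (fst p, d + snd p)) (at p)"
        by (intro tendsto_intros)
      moreover have "(\<lambda>p :: 'k \<times> 'k. (0, d) + p) = (\<lambda>p. (fst p, d + snd p))"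
        by (auto simp: fun_eq_iff plus_prod_def)
      ultimately show ?thesis by (simp only: isCont_def)
    qed
  qed
  ultimately have "compact S"
    using compact_Int_closed[of UNIV S] by simp
  then have "closed F"
    unfolding F_def
    by (intro compact_imp_closed compact_continuous_image continuous_on_fst continuous_on_id)
  have F_iff: "z \<in> F \<longleftrightarrow> (\<exists>y. (z, y) \<in> squares_closure \<and> (z, y + d) \<in> squares_closure)" for z
    by (force simp: F_def S_def image_iff plus_prod_def add.commute)
  have "z + \<tau> m \<in> F" if "z \<in> F" for z m
  proof -
    from that obtain y where y: "(z, y) \<in> squares_closure" "(z, y + d) \<in> squares_closure"
      unfolding F_iff by blast
    obtain u where u: "(\<lambda>i. \<tau> (u i)) \<longlonglongrightarrow> z" "(\<lambda>i. \<tau> ((u i)\<^sup>2)) \<longlonglongrightarrow> y"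
      using y(1) by (rule squares_closureE)
    obtain v where v: "(\<lambda>i. \<tau> (v i)) \<longlonglongrightarrow> z" "(\<lambda>i. \<tau> ((v i)\<^sup>2)) \<longlonglongrightarrow> y + d"
      using y(2) by (rule squares_closureE)
    obtain r e where r: "strict_mono (r :: nat \<Rightarrow> nat)"
      and e: "(\<lambda>i. \<tau> (2 * m * u (r i))) \<longlonglongrightarrow> e"
      using compact_convergent_subseq[OF compact_UNIV, of "\<lambda>i. \<tau> (2 * m * u i)"] by blast
    note sub = LIMSEQ_subseq_LIMSEQ[OF _ r, unfolded o_def]
    have "(\<lambda>i. \<tau> (v i) - \<tau> (u i)) \<longlonglongrightarrow> z - z" by (intro tendsto_intros u v)
    then have "(\<lambda>i. \<tau> (v i - u i)) \<longlonglongrightarrow> 0" by (simp add: diff)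
    from tendsto_add[OF e tendsto_mult_zero[OF sub[OF this], of "2 * m"]]
    \<comment> \<open>Both cross terms have the same limit \<open>e\<close>, so both points get the
      same vertical shift and their difference stays \<open>d\<close>.\<close>
    have e': "(\<lambda>i. \<tau> (2 * m * v (r i))) \<longlonglongrightarrow> e"
      by (simp add: add[symmetric] algebra_simps)
    have shift: "(z + \<tau> m, w + e + \<tau> (m\<^sup>2)) \<in> squares_closure"
      if lim: "(\<lambda>i. \<tau> (q i)) \<longlonglongrightarrow> z" "(\<lambda>i. \<tau> ((q i)\<^sup>2)) \<longlonglongrightarrow> w"
        "(\<lambda>i. \<tau> (2 * m * q (r i))) \<longlonglongrightarrow> e" for q w
    proof (rule squares_closureI)
      have "(\<lambda>i. \<tau> (q (r i)) + \<tau> m) \<longlonglongrightarrow> z + \<tau> m"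
        by (intro tendsto_intros sub[OF lim(1)])
      then show "(\<lambda>i. \<tau> (q (r i) + m)) \<longlonglongrightarrow> z + \<tau> m" by (simp add: add)
      have "(\<lambda>i. \<tau> ((q (r i))\<^sup>2) + \<tau> (2 * m * q (r i)) + \<tau> (m\<^sup>2)) \<longlonglongrightarrow> w + e + \<tau> (m\<^sup>2)"
        by (intro tendsto_intros sub[OF lim(2)] lim(3))
      then show "(\<lambda>i. \<tau> ((q (r i) + m)\<^sup>2)) \<longlonglongrightarrow> w + e + \<tau> (m\<^sup>2)"
        by (simp add: add[symmetric] power2_sum algebra_simps)
    qed
    have "(z + \<tau> m, y + e + \<tau> (m\<^sup>2)) \<in> squares_closure" by (rule shift[OF u e])
    moreover have "(z + \<tau> m, (y + e + \<tau> (m\<^sup>2)) + d) \<in> squares_closure"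
      using shift[OF v e'] by (simp add: add_ac)
    ultimately show ?thesis unfolding F_iff by blast
  qed
  moreover have "x \<in> F" using assms unfolding F_iff by blast
  ultimately have "F = UNIV" using \<open>closed F\<close> closed_invariant_UNIV by blast
  then obtain h where h: "h \<in> square_limits" "h + d \<in> square_limits"
    using F_iff[of 0] by (auto simp: square_limits_def)
  from square_limits_add[OF h(2) square_limits_uminus[OF h(1)]] show ?thesis by simp
qed

text \<open>Along a common subsequence \<open>j\<close> and \<open>j + n\<close> have the same limit
  \<open>x\<close>, while their squares differ in the limit by \<open>c + c + h\<close>. The error
  \<open>h\<close> comes from \<open>n\<^sup>2\<close> and itself lies in
  \<open>square_limits\<close>.\<close>

lemma double_square_limits: "c + c \<in> square_limits"
proof -
  obtain n where n: "\<And>i. n i > 0" "(\<lambda>i. \<tau> (n i)) \<longlonglongrightarrow> 0" by (rule recurrence) blast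
  \<comment> \<open>The dense set varies with \<open>i\<close>; the sequence \<open>j\<close> is a
    diagonal choice from these sets.\<close>
  have "c \<in> closure (range (\<lambda>j. \<tau> (n i * j)))" for i by (simp add: dense_multiples n)
  then obtain j where c: "(\<lambda>i. \<tau> (n i * j i)) \<longlonglongrightarrow> c" by (rule closure_range_sequence)
  have "compact (UNIV :: ('k \<times> 'k \<times> 'k) set)"
    using compact_Times[OF compact_UNIV compact_Times[OF compact_UNIV compact_UNIV]] by simp
  then obtain l r where r: "strict_mono (r :: nat \<Rightarrow> nat)"
    and l: "(\<lambda>i. (\<tau> (j (r i)), \<tau> ((j (r i))\<^sup>2), \<tau> ((n (r i))\<^sup>2))) \<longlonglongrightarrow> l"
    by (rule compact_convergent_subseq[of "\<lambda>i. (\<tau> (j i), \<tau> ((j i)\<^sup>2), \<tau> ((n i)\<^sup>2))"])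
  obtain x y h where "l = (x, y, h)" by (cases l)
  with l have x: "(\<lambda>i. \<tau> (j (r i))) \<longlonglongrightarrow> x" and y: "(\<lambda>i. \<tau> ((j (r i))\<^sup>2)) \<longlonglongrightarrow> y"
    and h: "(\<lambda>i. \<tau> ((n (r i))\<^sup>2)) \<longlonglongrightarrow> h"
    using tendsto_fst[OF l] tendsto_fst[OF tendsto_snd[OF l]] tendsto_snd[OF tendsto_snd[OF l]]
    by auto
  note sub = LIMSEQ_subseq_LIMSEQ[OF _ r, unfolded o_def]
  have "h \<in> square_limits"
    unfolding square_limits_def using squares_closureI[OF sub[OF n(2)] h] by simp
  have "(x, y + (c + c + h)) \<in> squares_closure"
  proof (rule squares_closureI)
    have "(\<lambda>i. \<tau> (j (r i)) + \<tau> (n (r i))) \<longlonglongrightarrow> x + 0"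
      by (intro tendsto_intros x sub[OF n(2)])
    then show "(\<lambda>i. \<tau> (j (r i) + n (r i))) \<longlonglongrightarrow> x" by (simp add: add)
    have "(\<lambda>i. \<tau> ((j (r i))\<^sup>2) + (\<tau> (n (r i) * j (r i)) + \<tau> (n (r i) * j (r i)) + \<tau> ((n (r i))\<^sup>2)))
        \<longlonglongrightarrow> y + (c + c + h)"
      by (intro tendsto_intros y h sub[OF c])
    then show "(\<lambda>i. \<tau> ((j (r i) + n (r i))\<^sup>2)) \<longlonglongrightarrow> y + (c + c + h)"
      by (simp add: add[symmetric] power2_sum algebra_simps)
  qed
  with squares_closureI[OF x y] have "c + c + h \<in> square_limits"
    by (rule squares_closure_fibre)
  from square_limits_add[OF this square_limits_uminus[OF \<open>h \<in> square_limits\<close>]]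
  show ?thesis by simp
qed

text \<open>Images of even integers are doubles, and they are already dense.\<close>

lemma square_limits_UNIV: "square_limits = UNIV"
proof -
  have "\<tau> (2 * j) \<in> square_limits" for j
    using double_square_limits[of "\<tau> j"] by (simp add: add[symmetric])
  then have "closure (range (\<lambda>j. \<tau> (2 * j))) \<subseteq> square_limits"
    by (intro closure_minimal closed_square_limits) auto
  then show ?thesis by (auto simp: dense_multiples)
qed

text \<open>Divisibility of the group: \<open>b\<close> solves k b = d. It is phrased by sequences
  because \<open>k\<close> multiplies integers, not group elements.\<close>

lemma divisible_limits:
  assumes "k > 0"
  obtains b where "\<And>w. (\<lambda>i. \<tau> (w i)) \<longlonglongrightarrow> b \<Longrightarrow> (\<lambda>i. \<tau> (k * w i)) \<longlonglongrightarrow> d"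
proof -
  have "d \<in> closure (range (\<lambda>j. \<tau> (k * j)))" using dense_multiples[OF assms] by simp
  then obtain v where v: "(\<lambda>i. \<tau> (k * v i)) \<longlonglongrightarrow> d" by (rule closure_range_sequence)
  obtain b r where r: "strict_mono (r :: nat \<Rightarrow> nat)" and b: "(\<lambda>i. \<tau> (v (r i))) \<longlonglongrightarrow> b"
    using compact_convergent_subseq[OF compact_UNIV, of "\<lambda>i. \<tau> (v i)"] by blast
  show thesis
  proof (rule that)
    fix w assume w: "(\<lambda>i. \<tau> (w i)) \<longlonglongrightarrow> b"
    have "(\<lambda>i. \<tau> (w i - v (r i))) \<longlonglongrightarrow> 0"
      using tendsto_diff[OF w b] by (simp add: diff)
    from tendsto_add[OF tendsto_mult_zero[OF this, of k] LIMSEQ_subseq_LIMSEQ[OF v r]]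
    show "(\<lambda>i. \<tau> (k * w i)) \<longlonglongrightarrow> d"
      by (simp add: o_def add[symmetric] algebra_simps)
  qed
qed

lemma scaled_square_limits:
  assumes "k > 0"
  obtains u where "(\<lambda>i. \<tau> (u i)) \<longlonglongrightarrow> 0" and "(\<lambda>i. \<tau> (k * (u i)\<^sup>2)) \<longlonglongrightarrow> d"
proof -
  obtain b where b: "\<And>w. (\<lambda>i. \<tau> (w i)) \<longlonglongrightarrow> b \<Longrightarrow> (\<lambda>i. \<tau> (k * w i)) \<longlonglongrightarrow> d"
    using divisible_limits[OF assms] by blast
  have "(0, b) \<in> squares_closure"
    using square_limits_UNIV by (auto simp: square_limits_def)
  then obtain u where "(\<lambda>i. \<tau> (u i)) \<longlonglongrightarrow> 0" "(\<lambda>i. \<tau> ((u i)\<^sup>2)) \<longlonglongrightarrow> b"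
    by (rule squares_closureE)
  then show thesis by (intro that[of u] b)
qed

section \<open>Solving the quadratic equation inside the Bohr set\<close>

lemma positive_shifted_square:
  assumes U: "open U" "0 \<in> U"
  obtains s where "s\<^sup>2 + n > 0" and "\<tau> (s\<^sup>2 + n) \<in> U"
proof -
  \<comment> \<open>The candidates are s = m (1 + 2 t). An odd multiple of \<open>m\<close> is never
    0, so its square is at least \<open>m\<close>, which exceeds the absolute value of
    \<open>n\<close>: positivity holds for every t, and t is free to steer the image towards
    0.\<close>
  define m where "m = \<bar>n\<bar> + 1"
  have "m > 0" by (simp add: m_def)
  then have "4 * m\<^sup>2 > 0" by simp
  then obtain u where u: "(\<lambda>i. \<tau> (u i)) \<longlonglongrightarrow> 0"
    "(\<lambda>i. \<tau> (4 * m\<^sup>2 * (u i)\<^sup>2)) \<longlonglongrightarrow> - \<tau> (m\<^sup>2 + n)"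
    by (rule scaled_square_limits)
  have "(\<lambda>i. \<tau> (m\<^sup>2 + n) + \<tau> (4 * m\<^sup>2 * u i) + \<tau> (4 * m\<^sup>2 * (u i)\<^sup>2))
      \<longlonglongrightarrow> \<tau> (m\<^sup>2 + n) + 0 + - \<tau> (m\<^sup>2 + n)"
    by (intro tendsto_add tendsto_const u tendsto_mult_zero)
  moreover have "\<tau> (m\<^sup>2 + n) + \<tau> (4 * m\<^sup>2 * t) + \<tau> (4 * m\<^sup>2 * t\<^sup>2) = \<tau> ((m * (1 + 2 * t))\<^sup>2 + n)"
    for t
    by (simp add: add[symmetric] power2_eq_square algebra_simps)
  ultimately have "(\<lambda>i. \<tau> ((m * (1 + 2 * u i))\<^sup>2 + n)) \<longlonglongrightarrow> 0" by simp
  from topological_tendstoD[OF this U]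
  obtain t where t: "\<tau> ((m * (1 + 2 * t))\<^sup>2 + n) \<in> U"
    by (auto simp: eventually_sequentially)
  have "1 + 2 * t \<noteq> 0" by presburger
  then have "(1 + 2 * t)\<^sup>2 \<ge> 1" by (simp add: int_one_le_iff_zero_less)
  then have "m\<^sup>2 * (1 + 2 * t)\<^sup>2 \<ge> m\<^sup>2 * 1" by (intro mult_left_mono) auto
  moreover have "m\<^sup>2 \<ge> m * 1"
    unfolding power2_eq_square using \<open>m > 0\<close> by (intro mult_left_mono) auto
  ultimately have "(m * (1 + 2 * t))\<^sup>2 + n > 0" by (simp add: power_mult_distrib m_def)
  with t show thesis using that by blast
qed

lemma representation:
  assumes U: "open U" "0 \<in> U"
  obtains x y z where "\<tau> x \<in> U" "\<tau> y \<in> U" "\<tau> z \<in> U" "x * y - z\<^sup>2 = n"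
proof -
  obtain s where s: "s\<^sup>2 + n > 0" "\<tau> (s\<^sup>2 + n) \<in> U"
    using positive_shifted_square[OF U] by blast
  define x where "x = s\<^sup>2 + n"
  have "x > 0" using s by (simp add: x_def)
  \<comment> \<open>First stage: an integer \<open>p\<close> puts z into the Bohr set and is then
    frozen.\<close>
  have "- \<tau> s \<in> closure (range (\<lambda>j. \<tau> (x * j)))" using dense_multiples[OF \<open>x > 0\<close>] by simp
  then obtain v where v: "(\<lambda>i. \<tau> (x * v i)) \<longlonglongrightarrow> - \<tau> s" by (rule closure_range_sequence)
  have "(\<lambda>i. \<tau> (s + x * v i)) \<longlonglongrightarrow> 0"
    using tendsto_add[OF tendsto_const v, of "\<tau> s"] by (simp add: add)
  from topological_tendstoD[OF this U] obtain p where p: "\<tau> (s + x * p) \<in> U"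
    by (auto simp: eventually_sequentially)
  \<comment> \<open>Second stage: with t = p + u, the linear terms in u vanish in the limit, so z
    stays near \<open>\<tau> (s + x * p)\<close>, while \<open>x * (u i)\<^sup>2\<close> cancels the
    constant part of y.\<close>
  obtain u where u: "(\<lambda>i. \<tau> (u i)) \<longlonglongrightarrow> 0"
    "(\<lambda>i. \<tau> (x * (u i)\<^sup>2)) \<longlonglongrightarrow> - \<tau> (1 + 2 * s * p + x * p\<^sup>2)"
    using scaled_square_limits[OF \<open>x > 0\<close>] by blast
  have "(\<lambda>i. \<tau> (s + x * p) + \<tau> (x * u i)) \<longlonglongrightarrow> \<tau> (s + x * p) + 0"
    by (intro tendsto_add tendsto_const u tendsto_mult_zero)
  moreover have "\<tau> (s + x * p) + \<tau> (x * q) = \<tau> (s + x * (p + q))" for q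
    by (simp add: add[symmetric] algebra_simps)
  ultimately have z: "(\<lambda>i. \<tau> (s + x * (p + u i))) \<longlonglongrightarrow> \<tau> (s + x * p)" by simp
  have "(\<lambda>i. \<tau> (1 + 2 * s * p + x * p\<^sup>2) + \<tau> ((2 * s + 2 * x * p) * u i) + \<tau> (x * (u i)\<^sup>2))
      \<longlonglongrightarrow> \<tau> (1 + 2 * s * p + x * p\<^sup>2) + 0 + - \<tau> (1 + 2 * s * p + x * p\<^sup>2)"
    by (intro tendsto_add tendsto_const u tendsto_mult_zero)
  moreover have "\<tau> (1 + 2 * s * p + x * p\<^sup>2) + \<tau> ((2 * s + 2 * x * p) * q) + \<tau> (x * q\<^sup>2)
      = \<tau> (1 + 2 * s * (p + q) + x * (p + q)\<^sup>2)" for q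
    by (simp add: add[symmetric] power2_eq_square algebra_simps)
  ultimately have y: "(\<lambda>i. \<tau> (1 + 2 * s * (p + u i) + x * (p + u i)\<^sup>2)) \<longlonglongrightarrow> 0" by simp
  have "\<forall>\<^sub>F i in sequentially. \<tau> (s + x * (p + u i)) \<in> U
      \<and> \<tau> (1 + 2 * s * (p + u i) + x * (p + u i)\<^sup>2) \<in> U"
    using topological_tendstoD[OF z U(1) p] topological_tendstoD[OF y U] by (rule eventually_conj)
  then obtain i where i: "\<tau> (s + x * (p + u i)) \<in> U"
    "\<tau> (1 + 2 * s * (p + u i) + x * (p + u i)\<^sup>2) \<in> U"
    by (auto simp: eventually_sequentially)
  have "x * (1 + 2 * s * t + x * t\<^sup>2) - (s + x * t)\<^sup>2 = x - s\<^sup>2" for t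
    by (simp add: power2_eq_square algebra_simps)
  then have "x * (1 + 2 * s * (p + u i) + x * (p + u i)\<^sup>2) - (s + x * (p + u i))\<^sup>2 = n"
    by (simp add: x_def)
  with i s show thesis using that unfolding x_def by blast
qed

end

theorem corollary1p8:
  fixes E :: "int set"
  assumes "aperiodic_Bohr0 TYPE('k::{topological_ab_group_add, t2_space, second_countable_topology}) E"
  shows "{x * y - z\<^sup>2 | x y z. x \<in> E \<and> y \<in> E \<and> z \<in> E} = (UNIV :: int set)"
proof -
  obtain \<tau> :: "int \<Rightarrow> 'k" and U where \<tau>: "dense_integers \<tau>" and U: "open U" "0 \<in> U"
    and E: "E = \<tau> -` U"
    using assms unfolding aperiodic_Bohr0_def dense_integers_def by blast
  interpret dense_integers \<tau> by (rule \<tau>)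
  have "n \<in> {x * y - z\<^sup>2 | x y z. x \<in> E \<and> y \<in> E \<and> z \<in> E}" for n
  proof -
    obtain x y z where "\<tau> x \<in> U" "\<tau> y \<in> U" "\<tau> z \<in> U" "x * y - z\<^sup>2 = n"
      using U by (rule representation)
    then show ?thesis unfolding E by force
  qed
  then show ?thesis by (intro UNIV_eq_I[symmetric])
qed

end
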